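(* Let $n\ge 2$ and $d\ge 1$ be integers, let $\mathbf{W}\in\mathbb{R}^{n\times d}$ and $\mathbf{b}\in\mathbb{R}^n$, and let $A_{\mathbf{W},\mathbf{b}}=\{\mathbf{W}\mathbf{x}+\mathbf{b} : \mathbf{x}\in\mathbb{R}^d\}\subseteq\mathbb{R}^n$. For every permutation $\boldsymbol{\pi}=(\pi_1,\dots,\pi_n)$ of $\{1,\dots,n\}$, the Softmax classifier parametrised by $\mathbf{W}$ and $\mathbf{b}$ can rank the classes in the order of $\boldsymbol{\pi}$ (that is, there exists $\mathbf{x}\in\mathbb{R}^d$ with $P(c_{\pi_1}\mid\mathbf{x})<P(c_{\pi_2}\mid\mathbf{x})<\dots<P(c_{\pi_n}\mid\mathbf{x})$) if and only if $A_{\mathbf{W},\mathbf{b}}\cap\mathcal{R}_{\boldsymbol{\pi}}\neq\emptyset$, where $\mathcal{R}_{\boldsymbol{\pi}}$ is the region of the Braid Arrangement corresponding to $\boldsymbol{\pi}$. Moreover, if $d<n-1$, then there are regions of the Braid Arrangement that $A_{\mathbf{W},\mathbf{b}}$ does not intersect, i.e. there exists a permutation $\boldsymbol{\pi}$ of $\{1,\dots,n\}$ with $A_{\mathbf{W},\mathbf{b}}\cap\mathcal{R}_{\boldsymbol{\pi}}=\emptyset$.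
   Context: There are $n=|C|$ classes $c_1,\dots,c_n$. The Softmax classifier parametrised by $\mathbf{W}\in\mathbb{R}^{n\times d}$ (with $i$-th row, viewed as a column vector, $\mathbf{w}_{c_i}$) and $\mathbf{b}\in\mathbb{R}^n$ (with $i$-th entry $b_{c_i}$) assigns to an input $\mathbf{x}\in\mathbb{R}^d$ the class probabilities $$P(c_t\mid\mathbf{x})=\frac{e^{\mathbf{w}_{c_t}^\top\mathbf{x}+b_{c_t}}}{\sum_{i=1}^n e^{\mathbf{w}_{c_i}^\top\mathbf{x}+b_{c_i}}},\qquad 1\le t\le n.$$ The set $A_{\mathbf{W},\mathbf{b}}$ is the affine subspace spanned by $\mathbf{W}$ and $\mathbf{b}$ (the set of feasible logits). The Braid Arrangement in $\mathbb{R}^n$ is the set of hyperplanes $\mathcal{H}_{i,j}=\{\mathbf{y}\in\mathbb{R}^n : y_i-y_j=0\}$, $1\le i<j\le n$. Its regions are the connected components of $\mathbb{R}^n\setminus\bigcup_{i<j}\mathcal{H}_{i,j}$. They are in bijection with the permutations of $\{1,\dots,n\}$: the region corresponding to $\boldsymbol{\pi}=(\pi_1,\dots,\pi_n)$ is $\mathcal{R}_{\boldsymbol{\pi}}=\{\mathbf{y}\in\mathbb{R}^n : y_{\pi_1}<y_{\pi_2}<\dots<y_{\pi_n}\}$. *)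

theory Defs
  imports "HOL-Analysis.Analysis"
begin

(* The n classes are the elements of a finite linearly ordered type 'n, which plays the role of
   {1, ..., n} with n = CARD('n); inputs live in R^d with d = CARD('d).  A permutation
   (pi_1, ..., pi_n) is a function p :: 'n => 'n with p permutes UNIV, where p k stands for pi_k. *)

definition softmax_prob ::
  "real ^ 'd ^ 'n \<Rightarrow> real ^ 'n \<Rightarrow> real ^ 'd \<Rightarrow> 'n::finite \<Rightarrow> real" where
  "softmax_prob W b x t =
     exp (row t W \<bullet> x + b $ t) / (\<Sum>i\<in>UNIV. exp (row i W \<bullet> x + b $ i))"

(* Since 'n is linearly ordered, strict monotonicity of k |-> P(c_(p k) | x) is the chain
   P(c_(p 1) | x) < P(c_(p 2) | x) < ... < P(c_(p n) | x). *)
definition can_rank ::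
  "real ^ 'd ^ 'n::{finite,linorder} \<Rightarrow> real ^ 'n::{finite,linorder} \<Rightarrow> ('n \<Rightarrow> 'n) \<Rightarrow> bool" where
  "can_rank W b p \<longleftrightarrow> (\<exists>x. strict_mono (\<lambda>k. softmax_prob W b x (p k)))"

definition feasible_logits :: "real ^ 'd ^ 'n \<Rightarrow> real ^ 'n \<Rightarrow> (real ^ 'n) set" where
  "feasible_logits W b = {W *v x + b | x. True}"

definition braid_hyperplane :: "'n \<Rightarrow> 'n \<Rightarrow> (real ^ 'n) set" where
  "braid_hyperplane i j = {y. y $ i - y $ j = 0}"

definition braid_arrangement :: "(real ^ 'n::{finite,linorder}) set set" where
  "braid_arrangement = {braid_hyperplane i j | i j. i < j}"

definition braid_regions :: "(real ^ 'n::{finite,linorder}) set set" where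
  "braid_regions = components (UNIV - \<Union>braid_arrangement)"

definition braid_region :: "('n::{finite,linorder} \<Rightarrow> 'n) \<Rightarrow> (real ^ 'n::{finite,linorder}) set" where
  "braid_region p = {y. strict_mono (\<lambda>k. y $ p k)}"

end

(* If d < n - 1, some nonzero v is orthogonal to the columns of W and to the all-ones vector.
   Then v \<bullet> y = v \<bullet> b for every feasible y, and we may assume v \<bullet> b \<le> 0. For p sorting the entries
   of v in increasing order, the strict Chebyshev sum inequality gives v \<bullet> y > 0 on the region
   of p, so this region contains no feasible point. *)

theory Submission
  imports Defs
begin

text \<open>All classes share one positive denominator and \<open>exp\<close> is strictly
  increasing, so probabilities are ordered as the logits are.\<close>

lemma softmax_prob_less_iff:
  "softmax_prob W b x s < softmax_prob W b x t \<longleftrightarrow> (W *v x + b) $ s < (W *v x + b) $ t"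
proof -
  have "(\<Sum>i\<in>UNIV. exp (row i W \<bullet> x + b $ i)) > 0"
    by (intro sum_pos) auto
  then show ?thesis
    by (simp add: softmax_prob_def divide_less_cancel matrix_vector_mul_component row_def)
qed

lemma can_rank_iff: "can_rank W b p \<longleftrightarrow> feasible_logits W b \<inter> braid_region p \<noteq> {}"
  unfolding can_rank_def feasible_logits_def braid_region_def strict_mono_def
    softmax_prob_less_iff by blast

lemma convex_braid_region: "convex (braid_region p)"
proof (rule convexI)
  fix x y :: "real ^ 'a::{finite,linorder}" and u v :: real
  assume x: "x \<in> braid_region p" and y: "y \<in> braid_region p"
    and uv: "0 \<le> u" "0 \<le> v" "u + v = 1"
  show "u *\<^sub>R x + v *\<^sub>R y \<in> braid_region p"
    unfolding braid_region_def mem_Collect_eq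
  proof (rule strict_monoI)
    fix k l :: 'a assume "k < l"
    then have "x $ p k < x $ p l" "y $ p k < y $ p l"
      using x y by (auto simp: braid_region_def strict_mono_def)
    then have "u * (x $ p k - x $ p l) + v * (y $ p k - y $ p l) < 0"
      using uv by (intro convex_bound_lt) auto
    then show "(u *\<^sub>R x + v *\<^sub>R y) $ p k < (u *\<^sub>R x + v *\<^sub>R y) $ p l"
      by (simp add: algebra_simps)
  qed
qed

lemma braid_region_nonempty:
  fixes p :: "'n::{finite,linorder} \<Rightarrow> 'n"
  assumes "p permutes UNIV"
  shows "braid_region p \<noteq> {}"
proof -
  \<comment> \<open>The witness gives coordinate \<open>p k\<close> the number of elements below
    \<open>k\<close>, which is strictly increasing in \<open>k\<close>.\<close>
  have "(\<chi> i. real (card {..<inv p i})) \<in> braid_region p"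
    using assms
    by (auto simp: braid_region_def permutes_inverses intro!: strict_monoI psubset_card_mono)
  then show ?thesis by blast
qed

text \<open>Ties the explicit inequalities to the topological notion of region. The set is connected
  because it is convex, and it is maximal because leaving it within a connected set means crossing a
  hyperplane.\<close>

lemma braid_region_in_braid_regions:
  fixes p :: "'n::{finite,linorder} \<Rightarrow> 'n"
  assumes p: "p permutes UNIV"
  shows "braid_region p \<in> braid_regions"
proof -
  have compl: "y \<in> UNIV - \<Union>braid_arrangement \<longleftrightarrow> (\<forall>i j. i \<noteq> j \<longrightarrow> y $ i \<noteq> y $ j)"
    for y :: "real ^ 'n::{finite,linorder}"
  proof -
    have "y \<in> UNIV - \<Union>braid_arrangement \<longleftrightarrow> (\<forall>i j. i < j \<longrightarrow> y $ i \<noteq> y $ j)"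
      by (auto simp: braid_arrangement_def braid_hyperplane_def)
    also have "\<dots> \<longleftrightarrow> (\<forall>i j. i \<noteq> j \<longrightarrow> y $ i \<noteq> y $ j)"
      by (metis less_irrefl neq_iff)
    finally show ?thesis .
  qed
  have sub: "braid_region p \<subseteq> UNIV - \<Union>braid_arrangement"
  proof (rule subsetI, unfold compl, clarify)
    fix y :: "real ^ 'n::{finite,linorder}" and i j
    assume y: "y \<in> braid_region p" and ij: "i \<noteq> j" "y $ i = y $ j"
    from y have "inj (\<lambda>k. y $ p k)"
      by (simp add: braid_region_def strict_mono_imp_inj_on)
    moreover have "y $ p (inv p i) = y $ p (inv p j)"
      using ij by (simp add: permutes_inverses(1)[OF p])
    ultimately have "inv p i = inv p j" by (rule injD)
    then have "p (inv p i) = p (inv p j)" by simp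
    with ij show False by (simp add: permutes_inverses(1)[OF p])
  qed
  have max: "D \<subseteq> braid_region p"
    if D: "braid_region p \<subseteq> D" "D \<subseteq> UNIV - \<Union>braid_arrangement" "connected D" for D
  proof
    fix z assume z: "z \<in> D"
    obtain y where y: "y \<in> braid_region p" using braid_region_nonempty[OF p] by blast
    show "z \<in> braid_region p"
      unfolding braid_region_def mem_Collect_eq
    proof (rule strict_monoI, rule ccontr)
      fix k l :: 'n assume kl: "k < l" and "\<not> z $ p k < z $ p l"
      \<comment> \<open>Intermediate values: the difference is negative at \<open>y\<close> and
        nonnegative at \<open>z\<close>, so it vanishes somewhere in \<open>D\<close>, and that
        point lies on a hyperplane.\<close>
      have "connected ((\<lambda>w. w $ p k - w $ p l) ` D)"
        by (intro connected_continuous_image D continuous_intros)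
      moreover have "y $ p k - y $ p l < 0"
        using y kl by (simp add: braid_region_def strict_mono_def)
      moreover have "z $ p k - z $ p l \<ge> 0" using \<open>\<not> _\<close> by simp
      ultimately have "0 \<in> (\<lambda>w. w $ p k - w $ p l) ` D"
        using D(1) y z by (meson connectedD_interval imageI in_mono less_imp_le)
      then obtain w where "w \<in> D" "w $ p k = w $ p l" by auto
      moreover have "p k \<noteq> p l" using kl permutes_inj[OF p] by (metis injD less_irrefl)
      ultimately show False using D(2) compl[of w] by blast
    qed
  qed
  show ?thesis
    unfolding braid_regions_def in_components_maximal
  proof (intro conjI allI impI)
    show "connected (braid_region p)"
      by (rule convex_connected[OF convex_braid_region])
  qed (use sub max braid_region_nonempty[OF p] in \<open>auto intro!: subset_antisym\<close>)
qed

lemma exists_sorting_permutation: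
  fixes v :: "'n::{finite,linorder} \<Rightarrow> real"
  shows "\<exists>p. p permutes UNIV \<and> mono (v \<circ> p)"
proof -
  \<comment> \<open>Any strictly increasing real weights would serve; counting the elements below
    \<open>k\<close> is one choice available on every finite linear order.\<close>
  define r where "r k = real (card {..<k})" for k :: 'n
  define F where "F p = (\<Sum>k\<in>UNIV. r k * v (p k))" for p
  let ?P = "{p. p permutes (UNIV :: 'n set)}"
  \<comment> \<open>A permutation maximising \<open>F\<close> is sorting: exchanging an inverted pair would increase \<open>F\<close>.\<close>
  have "finite ?P" "?P \<noteq> {}" using permutes_id[of UNIV] by (auto simp: finite_permutations simp del: permutes_id)
  then obtain p where p: "p permutes UNIV" and Fmax: "\<And>q. q permutes UNIV \<Longrightarrow> F q \<le> F p"
    using Max_in[of "F ` ?P"] Max_ge[of "F ` ?P"] by fastforce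
  have "v (p k) \<le> v (p l)" if kl: "k < l" for k l
  proof (rule ccontr)
    assume "\<not> v (p k) \<le> v (p l)"
    define q where "q = p \<circ> Transposition.transpose k l"
    have "q permutes UNIV"
      unfolding q_def by (intro permutes_compose p permutes_swap_id) auto
    have split: "F g = r k * v (g k) + r l * v (g l) + (\<Sum>i\<in>UNIV - {k, l}. r i * v (g i))" for g
      unfolding F_def using kl by (subst sum.subset_diff[of "{k, l}"]) auto
    have "(\<Sum>i\<in>UNIV - {k, l}. r i * v (q i)) = (\<Sum>i\<in>UNIV - {k, l}. r i * v (p i))"
      by (intro sum.cong) (auto simp: q_def Transposition.transpose_def)
    moreover have "q k = p l" "q l = p k" by (simp_all add: q_def)
    ultimately have "F q - F p = (r l - r k) * (v (p k) - v (p l))"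
      by (simp add: split[of q] split[of p] algebra_simps)
    moreover have "r k < r l"
      unfolding r_def using kl by (auto intro!: psubset_card_mono)
    ultimately have "F q > F p"
      using \<open>\<not> v (p k) \<le> v (p l)\<close> by (smt (verit) mult_pos_pos)
    with Fmax[OF \<open>q permutes UNIV\<close>] show False by simp
  qed
  then have "mono (v \<circ> p)" by (auto intro!: monoI simp: order.order_iff_strict[where 'a = 'n])
  with p show ?thesis by blast
qed

text \<open>Chebyshev by symmetrization: summing \<open>(v $ i - v $ j) * (y $ i - y $ j)\<close>
  over all pairs gives \<open>2 * CARD('n) * (v \<bullet> y)\<close>, since the remaining terms
  contain the sum of \<open>v\<close>. No summand is negative.\<close>

lemma inner_pos_braid_region:
  fixes v y :: "real ^ 'n::{finite,linorder}"
  assumes p: "p permutes UNIV" and mono: "mono (\<lambda>k. v $ p k)" and y: "y \<in> braid_region p"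
    and "v \<noteq> 0" and sum0: "(\<Sum>i\<in>UNIV. v $ i) = 0"
  shows "v \<bullet> y > 0"
proof -
  \<comment> \<open>As \<open>v\<close> may have ties, \<open>p\<close> sorts it only weakly; a
    strict inequality in \<open>v\<close> still fixes the order of the positions, and tied pairs
    contribute zero to the sum.\<close>
  have less: "y $ i < y $ j" if "v $ i < v $ j" for i j
  proof -
    have "inv p i < inv p j"
      using that mono unfolding mono_def
      by (metis p permutes_inverses(1) linorder_not_less)
    then have "y $ p (inv p i) < y $ p (inv p j)"
      using y by (simp add: braid_region_def strict_mono_def)
    then show ?thesis by (simp add: permutes_inverses(1)[OF p])
  qed
  let ?t = "\<lambda>i j. (v $ i - v $ j) * (y $ i - y $ j)"
  have pos: "?t i j > 0" if "v $ i \<noteq> v $ j" for i j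
    using that less[of i j] less[of j i]
    by (cases "v $ i < v $ j") (auto intro: mult_neg_neg)
  then have nonneg: "?t i j \<ge> 0" for i j
    by (cases "v $ i = v $ j") (auto intro: less_imp_le)
  \<comment> \<open>Strictness needs one pair with different entries: a constant vector with zero
    sum would be zero.\<close>
  have "\<exists>i j. v $ i \<noteq> v $ j"
  proof (rule ccontr)
    assume "\<not> ?thesis"
    then have "(\<Sum>i\<in>UNIV. v $ i) = of_nat CARD('n) * v $ j" for j
      by (simp add: sum_constant[symmetric] del: sum_constant) (metis (lifting))
    with sum0 \<open>v \<noteq> 0\<close> show False by (simp add: vec_eq_iff)
  qed
  then obtain i j where "v $ i \<noteq> v $ j" by blast
  then have "(\<Sum>j\<in>UNIV. ?t i j) > 0"
    by (intro sum_pos2[of UNIV j "?t i"] pos nonneg) auto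
  then have "(\<Sum>i\<in>UNIV. \<Sum>j\<in>UNIV. ?t i j) > 0"
    by (intro sum_pos2[of UNIV i "\<lambda>i. \<Sum>j\<in>UNIV. ?t i j"] sum_nonneg nonneg) auto
  also have "(\<Sum>i\<in>UNIV. \<Sum>j\<in>UNIV. ?t i j) = 2 * real CARD('n) * (v \<bullet> y)"
    by (simp add: left_diff_distrib right_diff_distrib sum_subtractf sum.distrib
        sum_distrib_left[symmetric] sum_distrib_right[symmetric] sum0 inner_vec_def)
  finally show ?thesis by (simp add: zero_less_mult_iff)
qed

text \<open>The range of \<open>W\<close> and the all-ones vector span at most
  \<open>CARD('d) + 1\<close> dimensions, fewer than \<open>CARD('n)\<close>, which leaves room for
  an orthogonal vector.\<close>

lemma exists_orthogonal_direction:
  fixes W :: "real ^ 'd ^ 'n"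
  assumes "CARD('d) < CARD('n) - 1"
  obtains v :: "real ^ 'n" where "v \<noteq> 0" "\<And>x. v \<bullet> (W *v x) = 0" "(\<Sum>i\<in>UNIV. v $ i) = 0"
proof -
  \<comment> \<open>Here \<open>1\<close> is the all-ones vector; orthogonality to it is the
    zero-sum condition.\<close>
  let ?S = "insert 1 (range ((*v) W))"
  have "dim (range ((*v) W)) \<le> CARD('d)"
    using dim_image_le[OF matrix_vector_mul_linear, of W UNIV] by (simp add: dim_UNIV)
  then have "dim ?S < DIM(real ^ 'n)"
    using assms by (simp add: dim_insert) linarith
  then obtain v where v: "v \<noteq> 0" "\<And>w. w \<in> span ?S \<Longrightarrow> orthogonal v w"
    using orthogonal_to_subspace_exists by blast
  show thesis
  proof
    show "v \<bullet> (W *v x) = 0" for x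
      using v(2)[of "W *v x"] by (simp add: orthogonal_def span_base)
    show "(\<Sum>i\<in>UNIV. v $ i) = 0"
      using v(2)[of 1] by (simp add: orthogonal_def span_base inner_vec_def)
  qed (fact v(1))
qed

lemma exists_unreachable_braid_region:
  fixes W :: "real ^ 'd ^ 'n::{finite,linorder}" and b :: "real ^ 'n::{finite,linorder}"
  assumes "CARD('d) < CARD('n) - 1"
  shows "\<exists>p. p permutes UNIV \<and> feasible_logits W b \<inter> braid_region p = {}"
proof -
  obtain u :: "real ^ 'n::{finite,linorder}" where u: "u \<noteq> 0" "\<And>x. u \<bullet> (W *v x) = 0" "(\<Sum>i\<in>UNIV. u $ i) = 0"
    using exists_orthogonal_direction[OF assms] by blast
  \<comment> \<open>Negation preserves the other three properties of \<open>u\<close>, so the sign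
    can be chosen to suit \<open>b\<close>.\<close>
  define v where "v = (if u \<bullet> b \<le> 0 then u else - u)"
  have v: "v \<noteq> 0" "\<And>x. v \<bullet> (W *v x) = 0" "(\<Sum>i\<in>UNIV. v $ i) = 0" "v \<bullet> b \<le> 0"
    using u by (auto simp: v_def sum_negf)
  obtain p where p: "p permutes UNIV" "mono (\<lambda>k. v $ p k)"
    using exists_sorting_permutation[of "($) v"] by (auto simp: o_def)
  have "y \<notin> braid_region p" if y: "y \<in> feasible_logits W b" for y
  proof
    assume "y \<in> braid_region p"
    with p v have "v \<bullet> y > 0" by (intro inner_pos_braid_region)
    moreover have "v \<bullet> y = v \<bullet> b"
      using y v(2) by (auto simp: feasible_logits_def inner_add_right)
    ultimately show False using v(4) by simp
  qed
  with p show ?thesis by blast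
qed

theorem corollary1:
  fixes W :: "real ^ 'd ^ 'n::{finite,linorder}" and b :: "real ^ 'n::{finite,linorder}"
  assumes "CARD('n) \<ge> 2"
  shows "(\<forall>p. p permutes UNIV \<longrightarrow>
            (can_rank W b p \<longleftrightarrow> feasible_logits W b \<inter> braid_region p \<noteq> {})) \<and>
         (CARD('d) < CARD('n) - 1 \<longrightarrow>
            (\<exists>p. p permutes UNIV \<and> braid_region p \<in> braid_regions \<and>
                 feasible_logits W b \<inter> braid_region p = {}))"
  using can_rank_iff exists_unreachable_braid_region braid_region_in_braid_regions by blast

end
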